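(* Let $\mathcal{P}=\{P_1,P_2,P_3\}$ be a set of three directed spanning paths on a common finite vertex set $V$, and suppose that $\mathcal{P}$ admits a $\{\vec v_1,\vec v_2,\vec v_3\}$-monotone simultaneous embedding for some vectors $\vec v_1,\vec v_2,\vec v_3\in\mathbb{R}^2$. Then $\mathcal{P}$ admits a $\{\vec v_1',\vec v_2',\vec v_3'\}$-monotone simultaneous embedding for any vectors $\vec v_1',\vec v_2',\vec v_3'\in\mathbb{R}^2$ whose radial order around the origin is the same as that of $\vec v_1,\vec v_2,\vec v_3$.
   Context: A directed spanning path on $V$ is a simple directed path visiting every vertex of $V$ exactly once, directed from one end to the other. For a nonzero vector $\vec v\in\mathbb{R}^2$, a drawing of a digraph (vertices are distinct points, edges are curves) is $\vec v$-monotone if every edge is drawn as a directed curve that is monotonically increasing in direction $\vec v$. Given digraphs $G_1,\dots,G_k$ on the same vertex set $V$ and vectors $\vec v_1,\dots,\vec v_k$, a $\{\vec v_1,\dots,\vec v_k\}$-monotone simultaneous embedding consists of planar drawings $\Gamma_1,\dots,\Gamma_k$ such that $\Gamma_i$ is a $\vec v_i$-monotone drawing of $G_i$ for each $i$ (the vector $\vec v_i$ belongs to the $i$-th graph), and each vertex of $V$ is represented by the same point in all the drawings. Same radial order: directions are considered up to simultaneously reversing a path and its vector (so that all vectors may be assumed to point into a common half-plane). Accordingly, $\vec v_1',\vec v_2',\vec v_3'$ have the same radial order around the origin as $\vec v_1,\vec v_2,\vec v_3$ if the six rays spanned by $\pm\vec v_1',\pm\vec v_2',\pm\vec v_3'$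 appear around the origin in the same counterclockwise cyclic order (with the same coincidences) as the six rays spanned by $\pm\vec v_1,\pm\vec v_2,\pm\vec v_3$, under the correspondence $\pm\vec v_i\leftrightarrow\pm\vec v_i'$. *)

theory Defs
  imports
    "HOL-Analysis.Analysis"
    "Graph_Theory.Digraph"
    "Graph_Theory.Arc_Walk"
begin

definition directed_spanning_path :: "'a set \<Rightarrow> ('a, 'b) pre_digraph \<Rightarrow> bool" where
  "directed_spanning_path V G \<longleftrightarrow>
     verts G = V \<and>
     (\<exists>u p v. pre_digraph.apath G u p v \<and>
        set (pre_digraph.awalk_verts G u p) = V \<and> set p = arcs G)"

(* Edges are simple curves that avoid the points of non-incident vertices;
   simple_path rather than arc, so that loops are not excluded in advance. *)
definition drawing ::
  "('a, 'b) pre_digraph \<Rightarrow> ('a \<Rightarrow> real ^ 2) \<Rightarrow> ('b \<Rightarrow> real \<Rightarrow> real ^ 2) \<Rightarrow> bool" where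
  "drawing G pos curve \<longleftrightarrow>
     inj_on pos (verts G) \<and>
     (\<forall>e\<in>arcs G. simple_path (curve e) \<and>
        pathstart (curve e) = pos (tail G e) \<and>
        pathfinish (curve e) = pos (head G e) \<and>
        (\<forall>w\<in>verts G. pos w \<in> path_image (curve e) \<longrightarrow> w \<in> {tail G e, head G e}))"

definition planar_drawing ::
  "('a, 'b) pre_digraph \<Rightarrow> ('a \<Rightarrow> real ^ 2) \<Rightarrow> ('b \<Rightarrow> real \<Rightarrow> real ^ 2) \<Rightarrow> bool" where
  "planar_drawing G pos curve \<longleftrightarrow>
     drawing G pos curve \<and>
     (\<forall>e\<in>arcs G. \<forall>f\<in>arcs G. e \<noteq> f \<longrightarrow>
        path_image (curve e) \<inter> path_image (curve f)
          \<subseteq> pos ` ({tail G e, head G e} \<inter> {tail G f, head G f}))"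

(* Strictly increasing; meant for a nonzero direction v. *)
definition monotone_drawing ::
  "real ^ 2 \<Rightarrow> ('a, 'b) pre_digraph \<Rightarrow> ('a \<Rightarrow> real ^ 2) \<Rightarrow> ('b \<Rightarrow> real \<Rightarrow> real ^ 2) \<Rightarrow> bool" where
  "monotone_drawing v G pos curve \<longleftrightarrow>
     drawing G pos curve \<and>
     (\<forall>e\<in>arcs G. strict_mono_on {0..1} (\<lambda>t. curve e t \<bullet> v))"

definition admits_monotone_simultaneous_embedding ::
  "'a set \<Rightarrow> ('k::finite \<Rightarrow> ('a, 'b) pre_digraph) \<Rightarrow> ('k \<Rightarrow> real ^ 2) \<Rightarrow> bool" where
  "admits_monotone_simultaneous_embedding V G v \<longleftrightarrow>
     (\<forall>i. verts (G i) = V) \<and>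
     (\<exists>pos. \<forall>i. \<exists>curve.
        planar_drawing (G i) pos curve \<and> monotone_drawing (v i) (G i) pos curve)"

(* The counterclockwise angle in [0, 2 pi) from the ray spanned by a to the ray spanned by b,
   for nonzero a and b. *)
definition ccw_angle :: "real ^ 2 \<Rightarrow> real ^ 2 \<Rightarrow> real" where
  "ccw_angle a b = Arg2pi (Complex (b $ 1) (b $ 2) / Complex (a $ 1) (a $ 2))"

definition signed_ray :: "('k \<Rightarrow> real ^ 2) \<Rightarrow> 'k \<times> bool \<Rightarrow> real ^ 2" where
  "signed_ray v r = (if snd r then v (fst r) else - v (fst r))"

(* Turning counterclockwise from any of the rays spanned by the vectors v i and - v i, one meets
   the others in the same order as for w. Rays s and t coincide iff neither of them is met
   strictly before the other, so coincidences are preserved as well. The sign is part of the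
   correspondence: v i corresponds to w i, and - v i to - w i. *)
definition same_radial_order ::
  "('k::finite \<Rightarrow> real ^ 2) \<Rightarrow> ('k \<Rightarrow> real ^ 2) \<Rightarrow> bool" where
  "same_radial_order v w \<longleftrightarrow>
     (\<forall>r s t.
        ccw_angle (signed_ray v r) (signed_ray v s) < ccw_angle (signed_ray v r) (signed_ray v t)
        \<longleftrightarrow>
        ccw_angle (signed_ray w r) (signed_ray w s) < ccw_angle (signed_ray w r) (signed_ray w t))"

end

(* Having the same radial order implies the existence of positive scalars c i and an invertible linear
   map A with (A p) \<bullet> v' i = c i * (p \<bullet> v i) for all p and i. Applying A to the vertices and to the
   curves then turns one embedding into the other. The map A exists because the radial order
   determines the signs of all determinants of pairs of vectors, hence the signs of the
   coefficients that express one vector in terms of two independent others; the map given by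
   prescribing A on two of the vectors up to positive scalars can be adjusted to fit the third. If all vectors
   are parallel, any A that is right on one of them is right on all. *)
theory Submission
  imports Defs
begin

section \<open>Transport of an embedding by an injective linear map\<close>

lemma admits_monotone_simultaneous_embedding_linear:
  fixes A :: "real ^ 2 \<Rightarrow> real ^ 2"
  assumes lin: "linear A" and inj: "inj A"
    and pos_c: "\<And>i. 0 < c i" and A: "\<And>p i. A p \<bullet> v' i = c i * (p \<bullet> v i)"
    and adm: "admits_monotone_simultaneous_embedding V G v"
  shows "admits_monotone_simultaneous_embedding V G v'"
proof -
  from adm obtain pos where verts: "\<forall>i. verts (G i) = V"
    and ex: "\<forall>i. \<exists>curve. planar_drawing (G i) pos curve \<and> monotone_drawing (v i) (G i) pos curve"
    unfolding admits_monotone_simultaneous_embedding_def by blast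
  have mem: "A x \<in> A ` S \<longleftrightarrow> x \<in> S" for x S
    using inj by (simp add: inj_image_mem_iff)
  have "\<exists>curve. planar_drawing (G i) (A \<circ> pos) curve \<and> monotone_drawing (v' i) (G i) (A \<circ> pos) curve"
    for i
  proof -
    from ex obtain curve where pl: "planar_drawing (G i) pos curve"
      and mon: "monotone_drawing (v i) (G i) pos curve" by blast
    let ?curve = "\<lambda>e. A \<circ> curve e"
    have dr: "drawing (G i) (A \<circ> pos) ?curve"
      using pl inj unfolding planar_drawing_def drawing_def
      by (auto simp: simple_path_linear_image_eq[OF lin inj] pathstart_compose pathfinish_compose
          path_image_compose mem intro: comp_inj_on inj_on_subset)
    have "path_image (?curve e) \<inter> path_image (?curve f)
        \<subseteq> (A \<circ> pos) ` ({tail (G i) e, head (G i) e} \<inter> {tail (G i) f, head (G i) f})"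
      if "e \<in> arcs (G i)" "f \<in> arcs (G i)" "e \<noteq> f" for e f
    proof -
      have "path_image (curve e) \<inter> path_image (curve f)
          \<subseteq> pos ` ({tail (G i) e, head (G i) e} \<inter> {tail (G i) f, head (G i) f})"
        using pl that unfolding planar_drawing_def by blast
      \<comment> \<open>Injectivity makes the image of an intersection the intersection of the
        images, so no new crossings arise.\<close>
      then show ?thesis
        unfolding path_image_compose image_Int[OF inj, symmetric] image_comp[symmetric]
        by (rule image_mono)
    qed
    then have "planar_drawing (G i) (A \<circ> pos) ?curve"
      using dr unfolding planar_drawing_def by blast
    moreover have "monotone_drawing (v' i) (G i) (A \<circ> pos) ?curve"
      using dr mon pos_c[of i] unfolding monotone_drawing_def
      by (simp add: A strict_mono_on_def)
    ultimately show ?thesis by blast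
  qed
  then show ?thesis
    using verts unfolding admits_monotone_simultaneous_embedding_def by blast
qed

section \<open>Determinants of pairs of plane vectors and Cramer's rule\<close>

definition cross2 :: "real ^ 2 \<Rightarrow> real ^ 2 \<Rightarrow> real" where
  "cross2 a b = a $ 1 * b $ 2 - a $ 2 * b $ 1"

text \<open>The counterclockwise rotation by a right angle; pairing with it computes the
  determinant.\<close>

definition perp :: "real ^ 2 \<Rightarrow> real ^ 2" where
  "perp a = vector [- a $ 2, a $ 1]"

lemma inner_real2: "(a :: real ^ 2) \<bullet> b = a $ 1 * b $ 1 + a $ 2 * b $ 2"
  by (simp add: inner_vec_def sum_2)

lemma inner_perp: "perp a \<bullet> b = cross2 a b"
  by (simp add: perp_def inner_real2 cross2_def)

lemma cross2_minus_right: "cross2 a (- b) = - cross2 a b"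
  by (simp add: cross2_def)

lemma cross2_self: "cross2 a a = 0"
  by (simp add: cross2_def)

lemma cross2_commute: "cross2 b a = - cross2 a b"
  by (simp add: cross2_def)

lemma cross2_perp_pos: "a \<noteq> 0 \<Longrightarrow> 0 < cross2 a (perp a)"
  by (auto simp: cross2_def perp_def vec_eq_iff forall_2 sum_squares_gt_zero_iff)

text \<open>Cramer's rule for \<open>z\<close> in terms of \<open>x\<close> and \<open>y\<close>,
  paired with \<open>p\<close> and cleared of denominators, so that it also covers parallel
  \<open>x\<close> and \<open>y\<close>.\<close>

lemma cramer_inner:
  "cross2 x y * (p \<bullet> z) = cross2 z y * (p \<bullet> x) + cross2 x z * (p \<bullet> y)"
  by (simp add: cross2_def inner_real2 algebra_simps)

lemma ex_linear_inj_inner_scaled: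
  assumes xy: "cross2 x y \<noteq> 0" and xy': "cross2 x' y' \<noteq> 0"
    and \<alpha>: "0 < \<alpha>" and \<beta>: "0 < \<beta>"
  shows "\<exists>A. linear A \<and> inj A \<and> (\<forall>p. A p \<bullet> x' = \<alpha> * (p \<bullet> x)) \<and> (\<forall>p. A p \<bullet> y' = \<beta> * (p \<bullet> y))"
proof -
  \<comment> \<open>As \<open>perp x'\<close> is orthogonal to \<open>x'\<close> and
    \<open>perp y'\<close> to \<open>y'\<close>, each summand serves just one of the two conditions;
    the minus sign offsets \<open>cross2 y' x' = - cross2 x' y'\<close>.\<close>
  define A where "A p = ((\<beta> * (p \<bullet> y)) *\<^sub>R perp x' - (\<alpha> * (p \<bullet> x)) *\<^sub>R perp y') /\<^sub>R cross2 x' y'" for p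
  have lin: "linear A"
    by (rule linearI) (simp_all add: A_def inner_add_left algebra_simps)
  have Ax: "A p \<bullet> x' = \<alpha> * (p \<bullet> x)" for p
    using xy' by (simp add: A_def inner_diff_left inner_perp cross2_self cross2_commute[of y' x'])
  have Ay: "A p \<bullet> y' = \<beta> * (p \<bullet> y)" for p
    using xy' by (simp add: A_def inner_diff_left inner_perp cross2_self)
  have "p = 0" if "A p = 0" for p
  proof -
    have "p \<bullet> x = 0" "p \<bullet> y = 0"
      using Ax[of p] Ay[of p] that \<alpha> \<beta> by auto
    \<comment> \<open>Cramer's rule with \<open>z = p\<close>.\<close>
    then have "cross2 x y * (p \<bullet> p) = 0"
      by (simp add: cramer_inner)
    then show ?thesis using xy by simp
  qed
  then have "inj A"
    by (simp add: linear_injective_0[OF lin])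
  then show ?thesis using lin Ax Ay by blast
qed

lemma ex_pos_scale_of_sgn_eq:
  fixes s t :: real
  assumes "sgn s = sgn t"
  shows "\<exists>c>0. c * s = t"
proof (cases "s = 0")
  case True
  with assms show ?thesis by (intro exI[of _ 1]) (simp add: sgn_0_0)
next
  case False
  with assms have "0 < t / s"
    by (auto simp: sgn_if zero_less_divide_iff split: if_splits)
  with False show ?thesis by (intro exI[of _ "t / s"]) simp
qed

section \<open>Signs of determinants and inner products read off from the radial order\<close>

lemma Im_Complex_divide_pos_iff:
  assumes "a \<noteq> 0"
  shows "0 < Im (Complex (b $ 1) (b $ 2) / Complex (a $ 1) (a $ 2)) \<longleftrightarrow> 0 < cross2 a b"
proof -
  have "0 < (a $ 1)\<^sup>2 + (a $ 2)\<^sup>2"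
    using assms by (auto simp: vec_eq_iff forall_2 sum_power2_gt_zero_iff)
  then show ?thesis
    by (simp add: Im_divide cross2_def zero_less_divide_iff algebra_simps)
qed

lemma Complex_coords_nonzero: "a \<noteq> 0 \<Longrightarrow> Complex (a $ 1) (a $ 2) \<noteq> 0" for a :: "real ^ 2"
  by (auto simp: vec_eq_iff forall_2 complex_eq_iff)

lemma ccw_angle_self: "a \<noteq> 0 \<Longrightarrow> ccw_angle a a = 0"
  using Complex_coords_nonzero[of a] by (simp add: ccw_angle_def Arg2pi_eq_0)

lemma ccw_angle_minus:
  assumes "a \<noteq> 0"
  shows "ccw_angle a (- a) = pi"
proof -
  have "Complex ((- a) $ 1) ((- a) $ 2) = - Complex (a $ 1) (a $ 2)"
    by (simp add: complex_eq_iff)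
  then have "Complex ((- a) $ 1) ((- a) $ 2) / Complex (a $ 1) (a $ 2) = - 1"
    using Complex_coords_nonzero[OF assms] by simp
  then show ?thesis by (simp add: ccw_angle_def Arg2pi_eq_pi)
qed

text \<open>The determinant is positive iff the angle lies strictly between 0 and \<open>pi\<close>.
  Both bounds are written as angles to signed rays, so that \<open>same_radial_order\<close>
  transfers the comparisons.\<close>

lemma cross2_pos_iff_ccw_angle:
  assumes "a \<noteq> 0"
  shows "0 < cross2 a b \<longleftrightarrow>
    ccw_angle a a < ccw_angle a b \<and> ccw_angle a b < ccw_angle a (- a)"
  using assms
  by (simp add: ccw_angle_self ccw_angle_minus)
    (simp add: ccw_angle_def Arg2pi_lt_pi Im_Complex_divide_pos_iff)

lemma sgn_cross2_eq_of_same_radial_order: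
  assumes nz: "\<forall>i. v i \<noteq> 0" and nz': "\<forall>i. w i \<noteq> 0" and ord: "same_radial_order v w"
  shows "sgn (cross2 (v i) (v j)) = sgn (cross2 (w i) (w j))"
proof -
  have pos: "0 < cross2 (v i) (signed_ray v s) \<longleftrightarrow> 0 < cross2 (w i) (signed_ray w s)" for s
  proof -
    have "ccw_angle (v i) (signed_ray v s) < ccw_angle (v i) (signed_ray v t) \<longleftrightarrow>
        ccw_angle (w i) (signed_ray w s) < ccw_angle (w i) (signed_ray w t)" for s t
      using ord[unfolded same_radial_order_def, rule_format, of "(i, True)" s t]
      by (simp add: signed_ray_def)
    from this[of "(i, True)" s] this[of s "(i, False)"] show ?thesis
      using nz nz' by (simp add: cross2_pos_iff_ccw_angle signed_ray_def)
  qed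
  \<comment> \<open>A negative determinant is detected as a positive one with the opposite ray
    \<open>- v j\<close>.\<close>
  from pos[of "(j, True)"] pos[of "(j, False)"] show ?thesis
    by (auto simp: signed_ray_def cross2_minus_right sgn_if)
qed

text \<open>For parallel vectors the determinant cannot tell equal from opposite directions, but the
  angle can: the quotient is a nonzero real, positive iff its argument is 0.\<close>

lemma inner_pos_iff_ccw_angle_of_parallel:
  assumes "a \<noteq> 0" "b \<noteq> 0" "cross2 a b = 0"
  shows "0 < a \<bullet> b \<longleftrightarrow> \<not> ccw_angle a a < ccw_angle a b"
proof -
  let ?z = "Complex (b $ 1) (b $ 2) / Complex (a $ 1) (a $ 2)"
  have d: "0 < (a $ 1)\<^sup>2 + (a $ 2)\<^sup>2"
    using assms(1) by (auto simp: vec_eq_iff forall_2 sum_power2_gt_zero_iff)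
  have "Im ?z = 0"
    using assms(3) by (simp add: Im_divide cross2_def algebra_simps)
  moreover have "0 < Re ?z \<longleftrightarrow> 0 < a \<bullet> b"
    using d by (simp add: Re_divide inner_real2 zero_less_divide_iff algebra_simps)
  moreover have "?z \<noteq> 0"
    using assms Complex_coords_nonzero by simp
  then have "Re ?z \<noteq> 0 \<or> Im ?z \<noteq> 0"
    by (simp only: complex_eq_iff) simp
  moreover have "0 \<le> Arg2pi ?z"
    by (rule Arg2pi_ge_0)
  ultimately show ?thesis
    using assms(1) Arg2pi_eq_0[of ?z]
    by (auto simp: ccw_angle_self complex_is_Real_iff) (auto simp: ccw_angle_def)
qed

lemma inner_nonzero_of_parallel:
  assumes "a \<noteq> 0" "b \<noteq> 0" "cross2 a b = 0"
  shows "a \<bullet> b \<noteq> 0"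
proof
  assume "a \<bullet> b = 0"
  \<comment> \<open>Cramer's rule for \<open>b\<close> in the basis \<open>a\<close>,
    \<open>perp a\<close>, paired with \<open>b\<close> itself: both terms vanish.\<close>
  then have "cross2 a (perp a) * (b \<bullet> b) = 0"
    using assms(3) cramer_inner[of a "perp a" b b] by (simp add: inner_commute)
  with assms cross2_perp_pos[of a] show False by simp
qed

section \<open>Construction of the linear map\<close>

lemma ex_linear_inj_of_same_radial_order:
  fixes v w :: "3 \<Rightarrow> real ^ 2"
  assumes nz: "\<forall>i. v i \<noteq> 0" and nz': "\<forall>i. w i \<noteq> 0" and ord: "same_radial_order v w"
  shows "\<exists>A c. linear A \<and> inj A \<and> (\<forall>i. 0 < c i) \<and> (\<forall>p i. A p \<bullet> w i = c i * (p \<bullet> v i))"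
proof -
  have scalars: ?thesis
    if "linear A" "inj A" "\<And>i. \<exists>c>0. \<forall>p. A p \<bullet> w i = c * (p \<bullet> v i)" for A
  proof -
    from that(3) obtain c where "\<And>i. 0 < c i \<and> (\<forall>p. A p \<bullet> w i = c i * (p \<bullet> v i))" by metis
    with that show ?thesis by blast
  qed
  note sgn = sgn_cross2_eq_of_same_radial_order[OF nz nz' ord]
  show ?thesis
  proof (cases "\<exists>i j. cross2 (v i) (v j) \<noteq> 0")
    case True
    then obtain i j where ij: "cross2 (v i) (v j) \<noteq> 0" by blast
    then have ij': "cross2 (w i) (w j) \<noteq> 0" using sgn by (metis sgn_0_0)
    from ij have "i \<noteq> j" by (auto simp: cross2_self)
    then obtain k where k: "\<And>l. l = i \<or> l = j \<or> l = k"
      by (metis (full_types) exhaust_3)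
    \<comment> \<open>The coefficients of \<open>u k\<close> in the basis \<open>u i\<close>,
      \<open>u j\<close>, used for \<open>u = v\<close> and \<open>u = w\<close>.\<close>
    let ?a = "\<lambda>u. cross2 (u k) (u j) / cross2 (u i) (u j)"
    let ?b = "\<lambda>u. cross2 (u i) (u k) / cross2 (u i) (u j)"
    have "sgn (?a w) = sgn (?a v)" "sgn (?b w) = sgn (?b v)"
      by (simp_all add: sgn_divide sgn)
    \<comment> \<open>The scalars for \<open>i\<close> and \<open>j\<close> are chosen to match the
      coefficients of the third vector, which then gets the factor 1.\<close>
    then obtain \<alpha> \<beta> where \<alpha>: "0 < \<alpha>" "\<alpha> * ?a w = ?a v" and \<beta>: "0 < \<beta>" "\<beta> * ?b w = ?b v"
      using ex_pos_scale_of_sgn_eq by metis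
    obtain A where A: "linear A" "inj A"
      and Ai: "\<And>p. A p \<bullet> w i = \<alpha> * (p \<bullet> v i)" and Aj: "\<And>p. A p \<bullet> w j = \<beta> * (p \<bullet> v j)"
      using ex_linear_inj_inner_scaled[OF ij ij' \<alpha>(1) \<beta>(1)] by blast
    have "A p \<bullet> w k = 1 * (p \<bullet> v k)" for p
    proof -
      have "A p \<bullet> w k = ?a w * (A p \<bullet> w i) + ?b w * (A p \<bullet> w j)"
        using cramer_inner[of "w i" "w j" "A p" "w k"] ij' by (simp add: field_simps)
      also have "\<dots> = (\<alpha> * ?a w) * (p \<bullet> v i) + (\<beta> * ?b w) * (p \<bullet> v j)"
        by (simp only: Ai Aj mult_ac)
      also have "\<dots> = ?a v * (p \<bullet> v i) + ?b v * (p \<bullet> v j)"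
        by (simp only: \<alpha> \<beta>)
      also have "\<dots> = p \<bullet> v k"
        using cramer_inner[of "v i" "v j" p "v k"] ij by (simp add: field_simps)
      finally show ?thesis by simp
    qed
    then have "\<exists>c>0. \<forall>p. A p \<bullet> w l = c * (p \<bullet> v l)" for l
      using k[of l] Ai Aj \<alpha>(1) \<beta>(1) zero_less_one by metis
    with A show ?thesis by (rule scalars)
  next
    case False
    then have par: "cross2 (v i) (v j) = 0" for i j by blast
    then have par': "cross2 (w i) (w j) = 0" for i j using sgn by (metis sgn_0_0)
    let ?x = "v 1" and ?y = "w 1"
    \<comment> \<open>The Binet-Cauchy identity: a vector \<open>z\<close> parallel to a nonzero
      \<open>x\<close> is \<open>x\<close> scaled by
      \<open>(x \<bullet> z) / (x \<bullet> x)\<close>.\<close>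
    have parallel: "(x \<bullet> x) * (p \<bullet> z) = (x \<bullet> z) * (p \<bullet> x)" if "cross2 x z = 0" for x z p
    proof -
      have "(x \<bullet> x) * (p \<bullet> z) - (x \<bullet> z) * (p \<bullet> x) = cross2 x p * cross2 x z"
        by (simp add: inner_real2 cross2_def algebra_simps)
      with that show ?thesis by simp
    qed
    \<comment> \<open>The \<open>perp\<close> vectors merely complete \<open>v 1\<close> and
      \<open>w 1\<close> to bases; only the condition on the first basis vector is kept.\<close>
    have "cross2 ?x (perp ?x) \<noteq> 0" "cross2 ?y (perp ?y) \<noteq> 0"
      using cross2_perp_pos nz nz' by (metis less_irrefl)+
    from ex_linear_inj_inner_scaled[OF this zero_less_one zero_less_one]
    obtain A where A: "linear A" "inj A" and A1: "\<And>p. A p \<bullet> ?y = p \<bullet> ?x" by auto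
    have "\<exists>c>0. \<forall>p. A p \<bullet> w l = c * (p \<bullet> v l)" for l
    proof -
      have "0 < ?x \<bullet> v l \<longleftrightarrow> 0 < ?y \<bullet> w l"
        using ord[unfolded same_radial_order_def, rule_format, of "(1, True)" "(1, True)" "(l, True)"]
          inner_pos_iff_ccw_angle_of_parallel par par' nz nz'
        by (simp add: signed_ray_def)
      moreover have "?x \<bullet> v l \<noteq> 0" "?y \<bullet> w l \<noteq> 0"
        using inner_nonzero_of_parallel par par' nz nz' by blast+
      ultimately have "sgn (?x \<bullet> v l) = sgn (?y \<bullet> w l)"
        by (simp add: sgn_if)
      then have "sgn ((?x \<bullet> v l) / (?x \<bullet> ?x)) = sgn ((?y \<bullet> w l) / (?y \<bullet> ?y))"
        using nz nz' by (simp add: sgn_divide)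
      \<comment> \<open>The ratio of the coefficient of \<open>w l\<close> along \<open>w 1\<close>
        to that of \<open>v l\<close> along \<open>v 1\<close>.\<close>
      then obtain c where c: "0 < c" "c * ((?x \<bullet> v l) / (?x \<bullet> ?x)) = (?y \<bullet> w l) / (?y \<bullet> ?y)"
        using ex_pos_scale_of_sgn_eq by blast
      have "A p \<bullet> w l = c * (p \<bullet> v l)" for p
      proof -
        have "A p \<bullet> w l = ((?y \<bullet> w l) / (?y \<bullet> ?y)) * (A p \<bullet> ?y)"
          using parallel[OF par', of 1 "A p" l] nz' by (simp add: field_simps)
        also have "\<dots> = c * (((?x \<bullet> v l) / (?x \<bullet> ?x)) * (p \<bullet> ?x))"
          by (simp only: A1 c(2)[symmetric] mult.assoc)
        also have "((?x \<bullet> v l) / (?x \<bullet> ?x)) * (p \<bullet> ?x) = p \<bullet> v l"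
          using parallel[OF par, of 1 p l] nz by (simp add: field_simps)
        finally show ?thesis .
      qed
      with c(1) show ?thesis by blast
    qed
    with A show ?thesis by (rule scalars)
  qed
qed

theorem theorem10:
  fixes V :: "'a set"
    and P :: "3 \<Rightarrow> ('a, 'b) pre_digraph"
    and v v' :: "3 \<Rightarrow> real ^ 2"
  assumes "finite V"
    and "\<forall>i. directed_spanning_path V (P i)"
    and "\<forall>i. v i \<noteq> 0"
    and "admits_monotone_simultaneous_embedding V P v"
    and "\<forall>i. v' i \<noteq> 0"
    and "same_radial_order v v'"
  shows "admits_monotone_simultaneous_embedding V P v'"
proof -
  obtain A c where "linear A" "inj A" "\<And>i. 0 < c i" "\<And>p i. A p \<bullet> v' i = c i * (p \<bullet> v i)"
    using ex_linear_inj_of_same_radial_order[OF assms(3,5,6)] by blast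
  then show ?thesis
    using assms(4) by (rule admits_monotone_simultaneous_embedding_linear)
qed

end
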